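(* For every integer $k\ge 0$, the set of $\mathcal{P}$-positions of the game $\mathcal{W}_1$ is identical to the set of $\mathcal{P}$-positions of the game $\mathcal{T}_k$.
   Context: All games here are two-player games. A position is a pair $(a,b)$ of nonnegative integers (sizes of two piles of tokens); the piles are unordered, so $(a,b)$ and $(b,a)$ are identified. Players alternate; a player who cannot move loses. In $\mathcal{W}_1$ each move is one of: (i) remove a positive number of tokens from a single pile; (ii) remove an equal positive number of tokens from both piles, provided that neither pile has size less than $1$ after the move. For an integer $k\ge 0$, in $\mathcal{T}_k$, from a position $(a,b)$ with $a\le b$, each move is one of: (i) remove a positive number of tokens from a single pile; (ii) remove an equal positive number $s$ of tokens from both piles, provided that $a-s>0$ and $\left|\left\lfloor \frac{b-s}{a-s}\right\rfloor-\left\lfloor\frac{b}{a}\right\rfloor\right|\le k$. A position is a $\mathcal{P}$-position if the player about to move from it does not have a winning strategy (the previous player wins); equivalently, if no move from it leads to a $\mathcal{P}$-position. *)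

theory Defs
  imports Complex_Main "HOL-Library.Uprod"
begin

text \<open>
  A game is given by its move relation: \<open>mv p q\<close> means that \<open>q\<close> can be reached from \<open>p\<close> in one move.
  The player about to move has a winning strategy iff some move leaves the opponent in a position from
  which every reply again gives the first player a winning strategy; if the opponent has no reply, they
  lose at once. Taking the least such predicate is right because plays are finite.
\<close>

inductive mover_wins :: "('p \<Rightarrow> 'p \<Rightarrow> bool) \<Rightarrow> 'p \<Rightarrow> bool" for mv :: "'p \<Rightarrow> 'p \<Rightarrow> bool" where
  "mv p q \<Longrightarrow> (\<And>r. mv q r \<Longrightarrow> mover_wins mv r) \<Longrightarrow> mover_wins mv p"

definition P_positions :: "('p \<Rightarrow> 'p \<Rightarrow> bool) \<Rightarrow> 'p set" where
  "P_positions mv = {p. \<not> mover_wins mv p}"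

text \<open>
  Positions are unordered pairs, so the rule \<open>single\<close> in each game below allows either pile to be
  reduced.
\<close>

inductive W1_move :: "nat uprod \<Rightarrow> nat uprod \<Rightarrow> bool" where
  single: "0 < s \<Longrightarrow> s \<le> a \<Longrightarrow> W1_move (Upair a b) (Upair (a - s) b)"
| both: "0 < s \<Longrightarrow> s \<le> a \<Longrightarrow> s \<le> b \<Longrightarrow> 1 \<le> a - s \<Longrightarrow> 1 \<le> b - s \<Longrightarrow>
    W1_move (Upair a b) (Upair (a - s) (b - s))"

inductive T_move :: "nat \<Rightarrow> nat uprod \<Rightarrow> nat uprod \<Rightarrow> bool" for k :: nat where
  single: "0 < s \<Longrightarrow> s \<le> a \<Longrightarrow> T_move k (Upair a b) (Upair (a - s) b)"
| both: "a \<le> b \<Longrightarrow> 0 < s \<Longrightarrow> s \<le> a \<Longrightarrow> a - s > 0 \<Longrightarrow>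
    \<bar>\<lfloor>real (b - s) / real (a - s)\<rfloor> - \<lfloor>real b / real a\<rfloor>\<bar> \<le> int k \<Longrightarrow>
    T_move k (Upair a b) (Upair (a - s) (b - s))"

lift_definition tokens :: "nat uprod \<Rightarrow> nat" is "\<lambda>(a, b). a + b"
  by auto

lemma W1_move_tokens: "W1_move p q \<Longrightarrow> tokens q < tokens p"
  by (induction rule: W1_move.induct) (simp_all add: tokens.abs_eq Upair.abs_eq)

lemma T_move_tokens: "T_move k p q \<Longrightarrow> tokens q < tokens p"
  by (induction rule: T_move.induct) (simp_all add: tokens.abs_eq Upair.abs_eq)

lemma P_positions_iff:
  fixes m :: "'p \<Rightarrow> nat"
  assumes dec: "\<And>p q. mv p q \<Longrightarrow> m q < m p"
  shows "p \<in> P_positions mv \<longleftrightarrow> (\<forall>q. mv p q \<longrightarrow> q \<notin> P_positions mv)"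
proof (induction p rule: measure_induct_rule[of m])
  case (less p)
  have "mover_wins mv p \<longleftrightarrow> (\<exists>q. mv p q \<and> (\<forall>r. mv q r \<longrightarrow> mover_wins mv r))"
    by (subst mover_wins.simps) blast
  moreover have "(\<forall>r. mv q r \<longrightarrow> mover_wins mv r) \<longleftrightarrow> \<not> mover_wins mv q" if "mv p q" for q
    using less[OF dec[OF that]] by (auto simp: P_positions_def)
  ultimately have "mover_wins mv p \<longleftrightarrow> (\<exists>q. mv p q \<and> \<not> mover_wins mv q)"
    by metis
  then show ?case
    unfolding P_positions_def mem_Collect_eq by blast
qed

lemma P_positions_W1_iff:
  "p \<in> P_positions W1_move \<longleftrightarrow> (\<forall>q. W1_move p q \<longrightarrow> q \<notin> P_positions W1_move)"
  by (rule P_positions_iff[OF W1_move_tokens])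

lemma P_positions_T_iff:
  "p \<in> P_positions (T_move k) \<longleftrightarrow> (\<forall>q. T_move k p q \<longrightarrow> q \<notin> P_positions (T_move k))"
  by (rule P_positions_iff[OF T_move_tokens])

end

theory Submission
  imports Defs
begin

text \<open>
  Every move of \<open>T_move k\<close> is a move of \<open>W1_move\<close>, so no move of the former joins two
  \<open>P\<close>-positions of the latter. By \<open>P_positions_eq_submoves\<close> it remains to see that restricting the
  diagonal moves never takes away the last winning move. In fact no winning move is lost: a
  diagonal move from \<open>(a, b)\<close> with \<open>a \<le> b\<close> into a \<open>P\<close>-position of \<open>W1_move\<close> leaves the quotient
  \<open>\<lfloor>b / a\<rfloor>\<close> equal to \<open>1\<close> at both ends, so it is allowed even for \<open>k = 0\<close>.

  The reason is that a \<open>P\<close>-position \<open>(a, b)\<close> of \<open>W1_move\<close> with \<open>1 \<le> a \<le> b\<close> satisfies \<open>b < 2 * a\<close>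
  (\<open>W1_P_lt_double\<close>), and the same inequality then holds for all positions further out on the same
  diagonal. The \<open>P\<close>-positions are \<open>(0, 0)\<close> and the Wythoff pairs shifted by one, so the inequality
  could be read off from the golden ratio formula, but a counting argument suffices: below
  a \<open>P\<close>-position with difference \<open>n\<close>, every smaller difference already occurs among the
  \<open>P\<close>-positions with nonempty piles (\<open>W1_P_smaller_differences\<close>), and distinct differences need
  distinct smaller piles, because positions sharing a pile are joined by a move. So there
  are at least \<open>n\<close> numbers in \<open>{1..<a}\<close>.
\<close>

text \<open>
  Deleting moves keeps a \<open>P\<close>-position safe, and a position outside the set stays winning as long as
  one winning move survives; these two properties determine the set by induction on the length of
  play.
\<close>

lemma P_positions_eq_submoves:
  fixes m :: "'p \<Rightarrow> nat"
  assumes dec: "\<And>p q. mv p q \<Longrightarrow> m q < m p"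
    and sub: "\<And>p q. mv' p q \<Longrightarrow> mv p q"
    and win: "\<And>p. p \<notin> P_positions mv \<Longrightarrow> \<exists>q. mv' p q \<and> q \<in> P_positions mv"
  shows "P_positions mv = P_positions mv'"
proof -
  have dec': "\<And>p q. mv' p q \<Longrightarrow> m q < m p"
    using dec sub by blast
  have "p \<in> P_positions mv \<longleftrightarrow> p \<in> P_positions mv'" for p
  proof (induction p rule: measure_induct_rule[of m])
    case (less p)
    have "p \<in> P_positions mv \<longleftrightarrow> (\<forall>q. mv' p q \<longrightarrow> q \<notin> P_positions mv)"
      using P_positions_iff[of mv m p, OF dec] sub win by blast
    also have "\<dots> \<longleftrightarrow> (\<forall>q. mv' p q \<longrightarrow> q \<notin> P_positions mv')"
      using less dec' by blast
    also have "\<dots> \<longleftrightarrow> p \<in> P_positions mv'"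
      using P_positions_iff[of mv' m p, OF dec'] by blast
    finally show ?case .
  qed
  then show ?thesis by blast
qed

lemma T_move_imp_W1_move: "T_move k p q \<Longrightarrow> W1_move p q"
  by (induction rule: T_move.induct) (auto intro: W1_move.intros)

lemma Upair_commute: "Upair a b = Upair b a"
  by simp

lemma W1_move_left: "c < a \<Longrightarrow> W1_move (Upair a b) (Upair c b)"
  using W1_move.single[of "a - c" a b] by simp

lemma W1_move_right: "c < b \<Longrightarrow> W1_move (Upair a b) (Upair a c)"
  using W1_move_left[of c b a] by (simp only: Upair_commute[of a])

lemma W1_move_cases:
  assumes "W1_move (Upair a b) q"
  obtains (left) c where "c < a" "q = Upair c b"
  | (right) c where "c < b" "q = Upair a c"
  | (both) s where "0 < s" "s < a" "s < b" "q = Upair (a - s) (b - s)"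
  using assms
proof cases
  case (single s x y)
  then consider "a = x" "b = y" | "a = y" "b = x" by auto
  then show ?thesis
  proof cases
    case 1
    then show ?thesis using single left[of "x - s"] by simp
  next
    case 2
    then show ?thesis using single right[of "x - s"] by simp
  qed
next
  case (both s x y)
  then consider "a = x" "b = y" | "a = y" "b = x" by auto
  then show ?thesis
    using both that(3)[of s] by cases auto
qed

lemma W1_P_no_move:
  "p \<in> P_positions W1_move \<Longrightarrow> W1_move p q \<Longrightarrow> q \<notin> P_positions W1_move"
  using P_positions_W1_iff by blast

lemma W1_P_pile_unique:
  assumes "Upair a b \<in> P_positions W1_move" "Upair a c \<in> P_positions W1_move"
  shows "b = c"
  using assms W1_P_no_move W1_move_right by (metis linorder_neqE_nat)

lemma W1_P_empty: "Upair 0 0 \<in> P_positions W1_move"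
  unfolding P_positions_W1_iff[of "Upair 0 0"] by (auto elim: W1_move_cases)

text \<open>
  The position with the same smaller pile \<open>a\<close> and difference \<open>d\<close> can be reached from \<open>(a, a + n)\<close>, so
  it must have a winning move of its own. That move cannot shorten the pile \<open>a + d\<close>, whose outcome
  would also be reachable from \<open>(a, a + n)\<close>. If it is diagonal, it exhibits the difference \<open>d\<close>; if it
  shortens the pile \<open>a\<close> to \<open>c\<close>, it reaches a \<open>P\<close>-position with smaller pile \<open>c < a\<close> and a difference
  exceeding \<open>d\<close>, where induction applies; here \<open>c > 0\<close> because \<open>(0, a + d)\<close> has a move to the
  \<open>P\<close>-position \<open>(0, 0)\<close>.
\<close>

lemma W1_P_smaller_differences:
  assumes "Upair a (a + n) \<in> P_positions W1_move" "0 < a" "d < n"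
  shows "\<exists>a'. 0 < a' \<and> a' < a \<and> Upair a' (a' + d) \<in> P_positions W1_move"
  using assms
proof (induction a arbitrary: n rule: less_induct)
  case (less a)
  have "Upair a (a + d) \<notin> P_positions W1_move"
    using W1_P_pile_unique[OF less.prems(1), of "a + d"] less.prems(3) by auto
  then obtain q where mv: "W1_move (Upair a (a + d)) q" and q: "q \<in> P_positions W1_move"
    using P_positions_W1_iff by blast
  from mv show ?case
  proof (cases rule: W1_move_cases)
    case (left c)
    have "c \<noteq> 0"
      using W1_P_pile_unique[OF W1_P_empty, of "a + d"] q left less.prems(2,3) by (cases c) auto
    then have "0 < c" by simp
    moreover have "Upair c (c + (a + d - c)) \<in> P_positions W1_move"
      using q left by simp
    moreover have "d < a + d - c"
      using left(1) by linarith
    ultimately obtain a' where "0 < a'" "a' < c" "Upair a' (a' + d) \<in> P_positions W1_move"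
      using less.IH[of c "a + d - c"] left(1) by blast
    then show ?thesis using left(1) by (meson less_trans)
  next
    case (right c)
    then show ?thesis
      using W1_P_pile_unique[OF less.prems(1), of c] q less.prems(3) by auto
  next
    case (both s)
    then have "q = Upair (a - s) (a - s + d)" by simp
    then show ?thesis using q both(1,2) by (intro exI[of _ "a - s"]) simp
  qed
qed

lemma W1_P_lt_double:
  assumes P: "Upair a b \<in> P_positions W1_move" and "0 < a" "a \<le> b"
  shows "b < 2 * a"
proof -
  define n where "n = b - a"
  have "Upair a (a + n) \<in> P_positions W1_move"
    using P \<open>a \<le> b\<close> by (simp add: n_def)
  then have "\<forall>d\<in>{..<n}. \<exists>a'. a' \<in> {1..<a} \<and> Upair a' (a' + d) \<in> P_positions W1_move"
    using W1_P_smaller_differences \<open>0 < a\<close> by (fastforce simp: Suc_le_eq)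
  then obtain f where f: "\<And>d. d < n \<Longrightarrow> f d \<in> {1..<a}"
    and fP: "\<And>d. d < n \<Longrightarrow> Upair (f d) (f d + d) \<in> P_positions W1_move"
    by (metis lessThan_iff)
  have "inj_on f {..<n}"
    using fP W1_P_pile_unique by (metis add_left_cancel inj_onI lessThan_iff)
  then have "card {..<n} \<le> card {1..<a}"
    using f by (intro card_inj_on_le[of f]) auto
  then show ?thesis using \<open>0 < a\<close> \<open>a \<le> b\<close> by (simp add: n_def)
qed

lemma floor_divide_eq_1:
  fixes a b :: nat
  assumes "a \<le> b" "b < 2 * a"
  shows "\<lfloor>real b / real a\<rfloor> = 1"
  using assms by (simp add: floor_eq_iff field_simps)

lemma T_winning_diagonal_move:
  assumes P: "Upair (a - s) (b - s) \<in> P_positions W1_move"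
    and "a \<le> b" "0 < s" "s < a"
  shows "T_move k (Upair a b) (Upair (a - s) (b - s))"
proof -
  have "b - s < 2 * (a - s)"
    using W1_P_lt_double[OF P] assms(2-) by simp
  then have "\<lfloor>real (b - s) / real (a - s)\<rfloor> = 1" "\<lfloor>real b / real a\<rfloor> = 1"
    using assms(2-) by (intro floor_divide_eq_1; linarith)+
  then show ?thesis
    using assms(2-) by (intro T_move.both) simp_all
qed

lemma W1_winning_move_imp_T_move:
  assumes "W1_move p q" "q \<in> P_positions W1_move"
  shows "T_move k p q"
  using assms
proof (induction rule: W1_move.induct)
  case (single s a b)
  then show ?case by (simp add: T_move.single)
next
  case (both s a b)
  then show ?case
    using T_winning_diagonal_move[of a s b k] T_winning_diagonal_move[of b s a k]
    by (cases "a \<le> b") (simp_all add: Upair_commute[of b] Upair_commute[of "b - s"])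
qed

theorem corollary12:
  fixes k :: nat
  shows "P_positions W1_move = P_positions (T_move k)"
proof (rule P_positions_eq_submoves[OF W1_move_tokens T_move_imp_W1_move])
  fix p assume "p \<notin> P_positions W1_move"
  then show "\<exists>q. T_move k p q \<and> q \<in> P_positions W1_move"
    using P_positions_W1_iff W1_winning_move_imp_T_move by blast
qed

end
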